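(* Let $p$ and $q$ be prime numbers with $p \ne q$, let $r$ be a positive integer, and let $\Delta \subset \mathbb{R}^d$ be a $d$-dimensional Gorenstein simplex of index $r$ whose normalized volume equals $pq$. Suppose that $\Delta$ is not a lattice pyramid over any lower-dimensional lattice simplex, and let $t$ be the unique interior lattice point of $r\Delta$. Let $s_1,s_2,s_3$ be nonnegative integers with $s_1+s_2+s_3=d+1$ such that $rpq = s_1 q + s_2 p + s_3$ and such that, for some ordering of the vertices of $\Delta$, $\Lambda_\Delta$ is generated by $$\Big(\underbrace{\tfrac1p,\ldots,\tfrac1p}_{s_1},\underbrace{\tfrac1q,\ldots,\tfrac1q}_{s_2},\underbrace{\tfrac1{pq},\ldots,\tfrac1{pq}}_{s_3}\Big) \in (\mathbb{R}/\mathbb{Z})^{d+1}.$$ Then $$\mathrm{Vol}((r\Delta - t)^\vee) = r\, p^{s_1+s_3-1} q^{s_2+s_3-1}.$$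
   Context: A lattice polytope is a convex polytope all of whose vertices have integer coordinates. $\mathrm{Vol}(\mathcal{P})$ denotes the normalized volume, i.e. $d!$ times the Euclidean volume of a $d$-dimensional lattice polytope $\mathcal{P}\subset\mathbb{R}^d$. For a $d$-dimensional lattice simplex $\Delta \subset \mathbb{R}^d$ with (ordered) vertices $v_0,\ldots,v_d \in \mathbb{Z}^d$, define the finite abelian group $$\Lambda_\Delta = \{(\lambda_0,\ldots,\lambda_d) \in (\mathbb{R}/\mathbb{Z})^{d+1} : \textstyle\sum_{i=0}^d \lambda_i (v_i,1) \in \mathbb{Z}^{d+1}\}$$ with componentwise addition. Two $d$-dimensional lattice polytopes in $\mathbb{R}^d$ are unimodularly equivalent if one is obtained from the other by $v \mapsto vU + w$ with $U \in \mathbb{Z}^{d\times d}$, $\det U = \pm 1$, $w \in \mathbb{Z}^d$. The lattice pyramid over $\mathcal{P}\subset\mathbb{R}^{d-1}$ is $\mathrm{Pyr}(\mathcal{P}) = \mathrm{conv}(\mathcal{P}\times\{0\}, (0,\ldots,0,1)) \subset \mathbb{R}^{d}$; $\Delta$ is called a lattice pyramid over a lower-dimensional lattice simplex if it is unimodularly equivalent to $\mathrm{Pyr}(\Delta')$ for some lattice simplex $\Delta'$ of dimension $d-1$. The dual polytope of $\mathcal{Q}\subset\mathbb{R}^d$ is $\mathcal{Q}^\vee = \{y \in \mathbb{R}^d : \langle x,y\rangle \le 1 \text{ for all } x \in \mathcal{Q}\}$. A $d$-dimensional lattice polytope $\mathcal{Q}$ is reflexive if the origin is the unique lattice point in its interior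 and $\mathcal{Q}^\vee$ is also a lattice polytope. A $d$-dimensional lattice polytope $\mathcal{P} \subset \mathbb{R}^d$ is Gorenstein of index $r$ ($r \in \mathbb{Z}_{>0}$) if there exist a reflexive polytope $\mathcal{Q} \subset \mathbb{R}^d$ and $w \in \mathbb{Z}^d$ with $\mathcal{Q} = r\mathcal{P} + w$; then $r\mathcal{P}$ has a unique interior lattice point $t$ and $\mathcal{Q} = r\mathcal{P} - t$. A Gorenstein simplex is a lattice simplex that is Gorenstein. *)

theory Defs
  imports "HOL-Analysis.Analysis" "HOL-Algebra.Product_Groups" "HOL-Algebra.Generated_Groups"
begin

text \<open>The dimension $d$ of the ambient space is \<open>CARD('n)\<close>.\<close>

definition integer_points :: "(real ^ 'n) set" where
  "integer_points = {x. \<forall>i. x $ i \<in> \<int>}"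

definition vertices :: "(real ^ 'n) set \<Rightarrow> (real ^ 'n) set" where
  "vertices P = {x. x extreme_point_of P}"

definition lattice_polytope :: "(real ^ 'n) set \<Rightarrow> bool" where
  "lattice_polytope P \<longleftrightarrow> polytope P \<and> vertices P \<subseteq> integer_points"

definition full_dim :: "(real ^ 'n) set \<Rightarrow> bool" where
  "full_dim P \<longleftrightarrow> aff_dim P = int CARD('n)"

definition normalized_volume :: "(real ^ 'n) set \<Rightarrow> real" where
  "normalized_volume P = fact CARD('n) * measure lebesgue P"

text \<open>Vectors are row vectors, as in $v \mapsto vU + w$.\<close>

definition unimodularly_equivalent :: "(real ^ 'n) set \<Rightarrow> (real ^ 'n) set \<Rightarrow> bool" where
  "unimodularly_equivalent P Q \<longleftrightarrow>
     (\<exists>(U :: real ^ 'n ^ 'n) w. (\<forall>i j. U $ i $ j \<in> \<int>) \<and> (det U = 1 \<or> det U = - 1) \<and>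
        w \<in> integer_points \<and> Q = (\<lambda>v. v v* U + w) ` P)"

text \<open>
  As $d$ is the cardinality of an index type, $\mathbb{R}^{d-1}$ is identified with a coordinate
  hyperplane \<open>{x. x $ k = 0}\<close> of \<open>real ^ 'n\<close>, which also covers $d - 1 = 0$. The index \<open>k\<close> plays
  the role of the last coordinate: a set \<open>P\<close> in that hyperplane is $P \times \{0\}$, and
  \<open>axis k 1\<close> is $(0,\ldots,0,1)$. The type \<open>'n\<close> has no distinguished last index; the choice
  of \<open>k\<close> is immaterial because permutations of the coordinates are unimodular.
\<close>

definition lattice_pyramid_over :: "'n \<Rightarrow> (real ^ 'n) set \<Rightarrow> (real ^ 'n) set" where
  "lattice_pyramid_over k P = convex hull (P \<union> {axis k 1})"

definition is_lattice_pyramid :: "(real ^ 'n) set \<Rightarrow> bool" where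
  "is_lattice_pyramid S \<longleftrightarrow>
     (\<exists>k S'. S' \<subseteq> {x. x $ k = 0} \<and> (int CARD('n) - 1) simplex S' \<and> lattice_polytope S' \<and>
        unimodularly_equivalent S (lattice_pyramid_over k S'))"

definition dual_polytope :: "(real ^ 'n) set \<Rightarrow> (real ^ 'n) set" where
  "dual_polytope Q = {y. \<forall>x\<in>Q. x \<bullet> y \<le> 1}"

definition reflexive_polytope :: "(real ^ 'n) set \<Rightarrow> bool" where
  "reflexive_polytope Q \<longleftrightarrow>
     lattice_polytope Q \<and> full_dim Q \<and> interior Q \<inter> integer_points = {0} \<and>
     lattice_polytope (dual_polytope Q)"

definition gorenstein :: "nat \<Rightarrow> (real ^ 'n) set \<Rightarrow> bool" where
  "gorenstein r P \<longleftrightarrow>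
     lattice_polytope P \<and> full_dim P \<and> r > 0 \<and>
     (\<exists>Q w. reflexive_polytope Q \<and> w \<in> integer_points \<and> Q = (\<lambda>x. real r *\<^sub>R x + w) ` P)"

definition real_group :: "real monoid" where
  "real_group = \<lparr>carrier = UNIV, monoid.mult = (+), one = 0\<rparr>"

definition class_mod_Z :: "real \<Rightarrow> real set" where
  "class_mod_Z x = \<int> #>\<^bsub>real_group\<^esub> x"

text \<open>$(\mathbb{R}/\mathbb{Z})^{d+1}$, with coordinates numbered $0,\ldots,d$:\<close>

definition torus :: "nat \<Rightarrow> (nat \<Rightarrow> real set) monoid" where
  "torus d = product_group {..d} (\<lambda>_. real_group Mod \<int>)"

definition torus_point :: "nat \<Rightarrow> (nat \<Rightarrow> real) \<Rightarrow> nat \<Rightarrow> real set" where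
  "torus_point d x = (\<lambda>i\<in>{..d}. class_mod_Z (x i))"

text \<open>
  The argument lists the vertices $v_0,\ldots,v_d$ in order. Since the \<open>v i\<close> are integral,
  the condition does not depend on the representative \<open>x\<close>.
\<close>

definition Lambda_group :: "(nat \<Rightarrow> real ^ 'n) \<Rightarrow> (nat \<Rightarrow> real set) set" where
  "Lambda_group v =
     {torus_point CARD('n) x | x.
        (\<Sum>i\<le>CARD('n). x i *\<^sub>R (v i, 1 :: real)) \<in> integer_points \<times> \<int>}"

lemma group_real_group: "comm_group real_group"
proof (rule comm_groupI)
  fix x assume "x \<in> carrier real_group"
  show "\<exists>y\<in>carrier real_group. y \<otimes>\<^bsub>real_group\<^esub> x = \<one>\<^bsub>real_group\<^esub>"
    by (rule bexI[of _ "- x"]) (auto simp: real_group_def)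
qed (auto simp: real_group_def)

lemma inv_real_group: "inv\<^bsub>real_group\<^esub> x = - x"
proof -
  interpret comm_group real_group by (rule group_real_group)
  show ?thesis by (rule inv_equality) (auto simp: real_group_def)
qed

lemma normal_Ints: "\<int> \<lhd> real_group"
proof -
  interpret comm_group real_group by (rule group_real_group)
  have "subgroup \<int> real_group"
    by (rule subgroupI) (auto simp: inv_real_group, auto simp: real_group_def)
  then show ?thesis by (rule subgroup_imp_normal)
qed

lemma group_torus: "group (torus d)"
  unfolding torus_def using normal.factorgroup_is_group[OF normal_Ints] by simp

lemma class_mod_Z_eq_iff: "class_mod_Z x = class_mod_Z y \<longleftrightarrow> x - y \<in> \<int>"
proof
  assume eq: "class_mod_Z x = class_mod_Z y"
  have "x \<in> class_mod_Z x"
    by (auto simp: class_mod_Z_def r_coset_def real_group_def intro!: bexI[of _ 0])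
  then show "x - y \<in> \<int>"
    unfolding eq by (auto simp: class_mod_Z_def r_coset_def real_group_def)
next
  assume d: "x - y \<in> \<int>"
  have *: "class_mod_Z x = {z. z - x \<in> \<int>}" for x
  proof (intro Set.set_eqI iffI)
    fix z assume "z \<in> {z. z - x \<in> \<int>}"
    then show "z \<in> class_mod_Z x"
      by (auto simp: class_mod_Z_def r_coset_def real_group_def intro!: bexI[of _ "z - x"])
  qed (auto simp: class_mod_Z_def r_coset_def real_group_def)
  have "z - x \<in> \<int> \<longleftrightarrow> z - y \<in> \<int>" for z
    using Ints_add[OF _ d, of "z - x"] Ints_diff[OF _ d, of "z - y"] by auto
  then show "class_mod_Z x = class_mod_Z y" by (simp add: *)
qed

lemma class_mod_Z_mult:
  "class_mod_Z x \<otimes>\<^bsub>real_group Mod \<int>\<^esub> class_mod_Z y = class_mod_Z (x + y)"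
  using normal.rcos_sum[OF normal_Ints, of x y]
  by (simp add: class_mod_Z_def FactGroup_def) (simp add: real_group_def)

lemma torus_point_mult:
  "torus_point d x \<otimes>\<^bsub>torus d\<^esub> torus_point d y = torus_point d (\<lambda>i. x i + y i)"
  unfolding torus_def torus_point_def mult_product_group
  by (rule restrict_ext) (simp add: class_mod_Z_mult del: mult_FactGroup)

lemma torus_point_in_carrier: "torus_point d x \<in> carrier (torus d)"
  by (auto simp: torus_def torus_point_def FactGroup_def RCOSETS_def class_mod_Z_def real_group_def)

lemma torus_one: "\<one>\<^bsub>torus d\<^esub> = torus_point d (\<lambda>_. 0)"
proof -
  interpret group "torus d" by (rule group_torus)
  show ?thesis
    using torus_point_mult[of d "\<lambda>_. 0" "\<lambda>_. 0"] torus_point_in_carrier r_cancel_one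
    by fastforce
qed

lemma torus_point_inv: "inv\<^bsub>torus d\<^esub> torus_point d x = torus_point d (\<lambda>i. - x i)"
proof -
  interpret group "torus d" by (rule group_torus)
  show ?thesis
    by (rule inv_equality) (auto simp: torus_point_mult torus_one torus_point_in_carrier)
qed

lemma subgroup_Lambda_group:
  fixes v :: "nat \<Rightarrow> real ^ 'n"
  shows "subgroup (Lambda_group v) (torus CARD('n))"
proof -
  interpret group "torus CARD('n)" by (rule group_torus)
  let ?S = "\<lambda>x. \<Sum>i\<le>CARD('n). x i *\<^sub>R (v i, 1 :: real)"
  let ?L = "(integer_points :: (real ^ 'n) set) \<times> (\<int> :: real set)"
  have zero: "?S (\<lambda>_. 0) \<in> ?L"
  proof -
    have "?S (\<lambda>_. 0) = 0"
      unfolding scaleR_zero_left by (rule sum.neutral) simp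
    moreover have "0 \<in> ?L"
      unfolding zero_prod_def by (simp add: integer_points_def)
    ultimately show ?thesis by metis
  qed
  have L_add: "a + b \<in> ?L" if "a \<in> ?L" "b \<in> ?L" for a b
    using that by (auto simp: integer_points_def)
  have L_minus: "- a \<in> ?L" if "a \<in> ?L" for a
    using that by (auto simp: integer_points_def)
  have add: "?S (\<lambda>i. x i + y i) \<in> ?L" if "?S x \<in> ?L" "?S y \<in> ?L" for x y
    unfolding scaleR_add_left sum.distrib by (rule L_add[OF that])
  have minus: "?S (\<lambda>i. - x i) \<in> ?L" if "?S x \<in> ?L" for x
    unfolding scaleR_minus_left sum_negf by (rule L_minus[OF that])
  have memI: "torus_point CARD('n) x \<in> Lambda_group v" if "?S x \<in> ?L" for x
    using that unfolding Lambda_group_def by (intro CollectI exI conjI) (rule refl, assumption)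
  show ?thesis
  proof (rule subgroupI)
    show "Lambda_group v \<subseteq> carrier (torus CARD('n))"
      by (auto simp: Lambda_group_def torus_point_in_carrier)
    show "Lambda_group v \<noteq> {}"
      using memI[OF zero] by auto
    fix a assume "a \<in> Lambda_group v"
    then obtain x where x: "a = torus_point CARD('n) x" "?S x \<in> ?L"
      unfolding Lambda_group_def by auto
    show "inv\<^bsub>torus CARD('n)\<^esub> a \<in> Lambda_group v"
      unfolding x(1) torus_point_inv by (rule memI[OF minus[OF x(2)]])
    fix b assume "b \<in> Lambda_group v"
    then obtain y where y: "b = torus_point CARD('n) y" "?S y \<in> ?L"
      unfolding Lambda_group_def by auto
    show "a \<otimes>\<^bsub>torus CARD('n)\<^esub> b \<in> Lambda_group v"
      unfolding x(1) y(1) torus_point_mult by (rule memI[OF add[OF x(2) y(2)]])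
  qed
qed

end

theory Submission
  imports Defs
begin

text \<open>Write \<open>\<lambda>\<^sub>i\<close> for the entries \<open>1/p\<close>, \<open>1/q\<close>, \<open>1/(p q)\<close> of the generator of \<open>\<Lambda>\<close> and \<open>d\<close> for
the dimension. The relation \<open>r p q = s1 q + s2 p + s3\<close> says \<open>\<Sum>i. \<lambda>\<^sub>i = r\<close>. Hence
\<open>\<tau> = \<Sum>i. \<lambda>\<^sub>i v\<^sub>i\<close> is \<open>r\<close> times a convex combination of the vertices with positive weights
\<open>b\<^sub>i = \<lambda>\<^sub>i / r\<close>, so it lies in the interior of \<open>r \<Delta>\<close>; and it is a lattice point, because the
generator belongs to \<open>\<Lambda>\<close>. As \<open>r \<Delta>\<close> has only one interior lattice point, \<open>t = \<tau>\<close>. In other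
words, the \<open>b\<^sub>i\<close> are the barycentric coordinates of the origin in the simplex \<open>W = r \<Delta> - t\<close>.

The volume of the dual is then governed by a general identity (\<open>dual_volume\<close>): if the origin
has positive barycentric coordinates \<open>b\<^sub>0, ..., b\<^sub>d\<close> in a simplex \<open>W\<close>, then
\<open>Vol(W) Vol(W\<^sup>\<or>) b\<^sub>0 ... b\<^sub>d = 1\<close>. Since \<open>Vol(W) = r\<^sup>d p q\<close> and
\<open>b\<^sub>0 ... b\<^sub>d = (p\<^bsup>s1+s3\<^esup> q\<^bsup>s2+s3\<^esup> r\<^bsup>d+1\<^esup>)\<^sup>-\<^sup>1\<close>, the claim follows.

To prove the identity, let \<open>M\<close> be the matrix with rows \<open>w\<^sub>1, ..., w\<^sub>d\<close>, the vertices of \<open>W\<close> other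
than \<open>w\<^sub>0\<close>. The map \<open>y \<mapsto> (b\<^sub>i (1 - \<langle>w\<^sub>i, y\<rangle>))\<^sub>i\<close> is affine with linear part of determinant
\<open>\<plusminus> b\<^sub>1 ... b\<^sub>d det M\<close>. It carries \<open>W\<^sup>\<or>\<close> onto the standard simplex: the remaining inequality
\<open>\<langle>w\<^sub>0, y\<rangle> \<le> 1\<close> turns into the condition that the coordinates sum to at most 1. So
\<open>Vol(W\<^sup>\<or>) = 1 / (b\<^sub>1 ... b\<^sub>d |det M|)\<close>. On the other hand \<open>Vol(W)\<close> is the determinant with rows
\<open>w\<^sub>i - w\<^sub>0\<close>. Because \<open>w\<^sub>0 = - \<Sum>i. (b\<^sub>i / b\<^sub>0) w\<^sub>i\<close>, this is \<open>M\<close> multiplied by a rank-one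
perturbation of the identity, whose determinant is \<open>1 + \<Sum>i. b\<^sub>i / b\<^sub>0 = 1 / b\<^sub>0\<close>.

The volume formula for linear images factors a matrix into elementary ones, for which the
coordinates have to be put in order; an arbitrary finite index type has no order. The identity is
therefore proved over well-ordered index types first and then transported along a relabelling of
the coordinates.\<close>

section \<open>Determinants of rank-one perturbations of the identity\<close>

text \<open>All rows other than row \<open>k\<close> are cleared of their multiple of \<open>\<beta>\<close> by subtracting a multiple of row
\<open>k\<close>; what is left is the identity with one row replaced, which is Cramer's rule.\<close>

lemma det_replace_row_rank_one:
  fixes c :: "'n::finite \<Rightarrow> 'a::field" and \<beta> :: "'a ^ 'n"
  assumes "finite S" "k \<notin> S"
  shows "det (\<chi> i. if i = k then \<beta> else if i \<in> S then axis i 1 + c i *s \<beta> else axis i 1) = \<beta> $ k"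
  using assms
proof (induction S rule: finite_induct)
  case empty
  have row_id: "row i (mat 1 :: 'a ^ 'n ^ 'n) = axis i 1" for i
    by (simp add: row_def mat_def axis_def vec_eq_iff)
  from cramer_lemma_transpose[of k \<beta> "mat 1"] show ?case
    by (simp add: row_id basis_expansion cong: if_cong)
next
  case (insert j S)
  let ?A = "\<chi> i. if i = k then \<beta> else if i \<in> S then axis i 1 + c i *s \<beta> else axis i 1"
  have "j \<noteq> k" using insert.prems by auto
  have "(\<chi> i. if i = k then \<beta> else if i \<in> insert j S then axis i 1 + c i *s \<beta> else axis i 1)
      = (\<chi> i. if i = j then row j ?A + c j *s row k ?A else row i ?A)"
    using \<open>j \<noteq> k\<close> insert.hyps by (auto simp: vec_eq_iff row_def)
  then show ?case
    using det_row_operation[OF \<open>j \<noteq> k\<close>, of ?A "c j"] insert by simp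
qed

text \<open>The matrix determinant lemma. The perturbation is switched on one row at a time: by linearity in
row \<open>k\<close>, doing so adds \<open>c k\<close> times the determinant computed above.\<close>

lemma det_id_plus_rank_one:
  fixes c :: "'n::finite \<Rightarrow> 'a::field" and \<beta> :: "'a ^ 'n"
  shows "det (\<chi> i. axis i 1 + c i *s \<beta>) = 1 + (\<Sum>i\<in>UNIV. c i * \<beta> $ i)"
proof -
  have "det (\<chi> i. if i \<in> S then axis i 1 + c i *s \<beta> else axis i 1) = 1 + (\<Sum>i\<in>S. c i * \<beta> $ i)"
    if "finite S" for S :: "'n set"
    using that
  proof (induction S rule: finite_induct)
    case empty
    have "(\<chi> i. axis i 1) = (mat 1 :: 'a ^ 'n ^ 'n)"
      by (simp add: mat_def axis_def vec_eq_iff)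
    then show ?case by simp
  next
    case (insert k S)
    let ?R = "\<lambda>i. if i \<in> S then axis i 1 + c i *s \<beta> else axis i 1"
    have "(\<chi> i. if i \<in> insert k S then axis i 1 + c i *s \<beta> else axis i 1)
        = (\<chi> i. if i = k then axis k 1 + c k *s \<beta> else ?R i)"
      by (simp add: vec_eq_iff)
    also have "det \<dots> = det (\<chi> i. if i = k then axis k 1 else ?R i)
        + c k * det (\<chi> i. if i = k then \<beta> else ?R i)"
      by (simp only: det_row_add[of k "\<lambda>_. axis k 1" "\<lambda>_. c k *s \<beta>"] det_row_mul)
    also have "(\<chi> i. if i = k then axis k 1 else ?R i) = (\<chi> i. ?R i)"
      using insert.hyps by (auto simp: vec_eq_iff)
    finally show ?case
      using insert det_replace_row_rank_one[OF insert.hyps, of \<beta> c] by simp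
  qed
  from this[of UNIV] show ?thesis by simp
qed

section \<open>Volumes of simplices and of their duals\<close>

lemma normalized_volume_convex_hull_simplex:
  fixes w :: "'n::{finite,wellorder} \<Rightarrow> real ^ 'n::_"
  assumes "inj w" "w0 \<notin> range w"
  shows "normalized_volume (convex hull (insert w0 (range w))) = \<bar>det (\<chi> i. w i - w0)\<bar>"
proof -
  let ?X = "insert w0 (range w)"
  have "card ?X = Suc CARD('n)"
    using assms by (simp add: card_image)
  moreover have "bij_betw w UNIV (?X - {w0})"
    using assms by (auto simp: bij_betw_def)
  ultimately have "measure lborel (convex hull ?X) = \<bar>det (\<chi> i j. w j $ i - w0 $ i)\<bar> / fact CARD('n)"
    by (intro content_simplex) auto
  also have "(\<chi> i j. w j $ i - w0 $ i) = transpose (\<chi> i. w i - w0)"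
    by (simp add: transpose_def vec_eq_iff)
  also have "measure lborel (convex hull ?X) = measure lebesgue (convex hull ?X)"
    using finite_imp_compact_convex_hull[of ?X]
    by (intro measure_completion[symmetric]) (auto dest: compact_imp_closed)
  finally show ?thesis
    by (simp add: normalized_volume_def)
qed

lemma std_simplex_cart:
  "convex hull (insert 0 Basis) = {x :: real ^ 'n. (\<forall>i. 0 \<le> x $ i) \<and> (\<Sum>i\<in>UNIV. x $ i) \<le> 1}"
proof -
  have Basis: "(Basis :: (real ^ 'n) set) = range (\<lambda>i. axis i 1)"
    by (auto simp: Basis_vec_def)
  have "inj (\<lambda>i::'n. axis i (1::real))"
    by (auto simp: inj_def axis_eq_axis)
  then show ?thesis
    unfolding std_simplex by (simp add: Basis sum.reindex inner_axis)
qed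

lemma normalized_volume_std_simplex:
  "normalized_volume (convex hull (insert 0 Basis) :: (real ^ 'n) set) = 1"
proof -
  let ?T = "convex hull (insert 0 Basis) :: (real ^ 'n) set"
  have "measure lebesgue ?T = measure lborel ?T"
    using finite_imp_compact_convex_hull[of "insert 0 Basis :: (real ^ 'n) set"]
    by (intro measure_completion) (auto dest: compact_imp_closed)
  then show ?thesis
    by (simp add: normalized_volume_def content_std_simplex)
qed

lemma dual_polytope_convex_hull: "dual_polytope (convex hull X) = dual_polytope X"
proof
  show "dual_polytope X \<subseteq> dual_polytope (convex hull X)"
  proof
    fix y assume "y \<in> dual_polytope X"
    then have "X \<subseteq> {x. x \<bullet> y \<le> 1}"
      by (auto simp: dual_polytope_def)
    moreover have "convex {x. x \<bullet> y \<le> 1}"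
      using convex_halfspace_le[of y 1] by (simp add: inner_commute)
    ultimately have "convex hull X \<subseteq> {x. x \<bullet> y \<le> 1}"
      by (rule hull_minimal)
    then show "y \<in> dual_polytope (convex hull X)"
      by (auto simp: dual_polytope_def)
  qed
  show "dual_polytope (convex hull X) \<subseteq> dual_polytope X"
    using hull_subset[of X convex] by (auto simp: dual_polytope_def)
qed

lemma closed_dual_polytope: "closed (dual_polytope Q)"
proof -
  have "dual_polytope Q = (\<Inter>x\<in>Q. {y. x \<bullet> y \<le> 1})"
    by (auto simp: dual_polytope_def)
  then show ?thesis
    by (auto intro!: closed_INT closed_halfspace_le)
qed

text \<open>The duality of volumes over a well-ordered index type, where one vertex \<open>w0\<close> is singled out so that
the others are indexed by the coordinates. Nonvanishing of the volume encodes that the vertices are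
affinely independent, in the form needed to invert the matrix of the \<open>w i\<close>.\<close>

lemma dual_volume_wellorder:
  fixes w :: "'n::{finite,wellorder} \<Rightarrow> real ^ 'n::_" and w0 :: "real ^ 'n::_" and b :: "'n::_ \<Rightarrow> real"
  defines "W \<equiv> convex hull (insert w0 (range w))"
  assumes "inj w" "w0 \<notin> range w"
    and b: "b0 > 0" "\<And>i. b i > 0" "b0 + (\<Sum>i\<in>UNIV. b i) = 1"
    and zero: "b0 *\<^sub>R w0 + (\<Sum>i\<in>UNIV. b i *\<^sub>R w i) = 0"
    and nz: "normalized_volume W \<noteq> 0"
  shows "normalized_volume W * normalized_volume (dual_polytope W) * (b0 * (\<Prod>i\<in>UNIV. b i)) = 1"
proof -
  define M :: "real ^ 'n::_ ^ 'n::_" where "M = (\<chi> i. w i)"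
  define \<beta> :: "real ^ 'n::_" where "\<beta> = (\<chi> i. b i / b0)"
  define bv :: "real ^ 'n::_" where "bv = (\<chi> i. b i)"
  define A :: "real ^ 'n::_ ^ 'n::_" where "A = (\<chi> i. (- b i) *s w i)"
  let ?T = "convex hull (insert 0 Basis) :: (real ^ 'n::_) set"

  have b0w0: "b0 *\<^sub>R w0 = - (\<Sum>i\<in>UNIV. b i *\<^sub>R w i)"
    using zero by (simp add: add_eq_0_iff)
  have w0: "w0 = - (\<Sum>i\<in>UNIV. \<beta> $ i *s w i)"
  proof -
    have "w0 = (1 / b0) *\<^sub>R (b0 *\<^sub>R w0)"
      using b by simp
    also have "\<dots> = - (\<Sum>i\<in>UNIV. \<beta> $ i *s w i)"
      unfolding b0w0 by (simp add: \<beta>_def scaleR_right.sum scalar_mult_eq_scaleR)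
    finally show ?thesis .
  qed
  \<comment> \<open>The volume of \<open>W\<close>: passing from the rows \<open>w i\<close> to the edge vectors \<open>w i - w0\<close> costs a factor
    \<open>1 / b0\<close>.\<close>
  have "(\<chi> i. w i - w0) = (\<chi> i. axis i 1 + 1 *s \<beta>) ** M"
  proof -
    have "(\<Sum>k\<in>UNIV. (axis i 1 + \<beta>) $ k *s w k) = w i - w0" for i
    proof -
      have "(\<Sum>k\<in>UNIV. (axis i 1 :: real ^ 'n::_) $ k *s w k) = (\<Sum>k\<in>UNIV. if k = i then w k else 0)"
        by (intro sum.cong) (auto simp: axis_def)
      then show ?thesis
        by (simp add: w0 vec.scale_left_distrib sum.distrib)
    qed
    then show ?thesis
      by (simp add: matrix_mul_sum_alt M_def)
  qed
  then have "det (\<chi> i. w i - w0) = (1 + (\<Sum>i\<in>UNIV. b i / b0)) * det M"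
    using det_id_plus_rank_one[of "\<lambda>_. 1" \<beta>] by (simp add: det_mul \<beta>_def)
  also have "1 + (\<Sum>i\<in>UNIV. b i / b0) = 1 / b0"
    using b by (simp add: sum_divide_distrib[symmetric] field_simps)
  finally have volW: "normalized_volume W = \<bar>det M\<bar> / b0"
    using normalized_volume_convex_hull_simplex[OF assms(2,3)] b
    by (simp add: W_def abs_mult)

  have detA: "\<bar>det A\<bar> = (\<Prod>i\<in>UNIV. b i) * \<bar>det M\<bar>"
    using b unfolding A_def M_def det_rows_mul by (simp add: abs_mult abs_prod less_imp_le)
  have "det M \<noteq> 0"
    using nz volW by auto
  moreover have prod: "(\<Prod>i\<in>UNIV. b i) > 0"
    using b by (simp add: prod_pos)
  ultimately have "det A \<noteq> 0"
    using detA by (metis abs_eq_0 less_irrefl mult_eq_0_iff)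
  then obtain B where AB: "A ** B = mat 1" and BA: "B ** A = mat 1"
    using invertible_det_nz invertible_def by metis
  have detB: "\<bar>det B\<bar> * \<bar>det A\<bar> = 1"
    using arg_cong[OF BA, of det] by (simp add: det_mul flip: abs_mult)

  \<comment> \<open>The affine map \<open>y \<mapsto> A y + bv\<close> has coordinates \<open>b i * (1 - w i \<bullet> y)\<close>; their sum is
    \<open>1 - b0 * (1 - w0 \<bullet> y)\<close>, so the inequality belonging to \<open>w0\<close> becomes the slanted facet of the
    standard simplex.\<close>
  have mem: "y \<in> dual_polytope W \<longleftrightarrow> A *v y + bv \<in> ?T" for y
  proof -
    have comp: "(A *v y + bv) $ i = b i * (1 - w i \<bullet> y)" for i
      by (simp add: A_def bv_def matrix_vector_mult_def inner_vec_def sum_distrib_left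
          algebra_simps sum_negf)
    have "b0 * (w0 \<bullet> y) = - (\<Sum>i\<in>UNIV. b i * (w i \<bullet> y))"
      using arg_cong[OF b0w0, of "\<lambda>x. x \<bullet> y"] by (simp add: inner_sum_left)
    then have sum: "(\<Sum>i\<in>UNIV. (A *v y + bv) $ i) = 1 - b0 * (1 - w0 \<bullet> y)"
      using b(3) unfolding comp by (simp add: algebra_simps sum_subtractf)
    have "y \<in> dual_polytope W \<longleftrightarrow> w0 \<bullet> y \<le> 1 \<and> (\<forall>i. w i \<bullet> y \<le> 1)"
      unfolding W_def dual_polytope_convex_hull by (auto simp: dual_polytope_def)
    also have "\<dots> \<longleftrightarrow> A *v y + bv \<in> ?T"
      unfolding std_simplex_cart mem_Collect_eq sum comp
      using b(1) b(2)[THEN less_le_not_le[THEN iffD1]] by (auto simp: zero_le_mult_iff)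
    finally show ?thesis .
  qed
  have "dual_polytope W = (\<lambda>x. - (B *v bv) + x) ` ((*v) B) ` ?T"
  proof (intro equalityI subsetI)
    fix y assume "y \<in> dual_polytope W"
    then have "A *v y + bv \<in> ?T" by (simp add: mem)
    moreover have "y = - (B *v bv) + B *v (A *v y + bv)"
      by (simp add: matrix_vector_right_distrib matrix_vector_mul_assoc BA)
    ultimately show "y \<in> (\<lambda>x. - (B *v bv) + x) ` ((*v) B) ` ?T" by blast
  next
    fix y assume "y \<in> (\<lambda>x. - (B *v bv) + x) ` ((*v) B) ` ?T"
    then obtain x where x: "x \<in> ?T" "y = B *v (x - bv)"
      by (auto simp: matrix_vector_mult_diff_distrib)
    then have "A *v y + bv = x"
      by (simp add: matrix_vector_mul_assoc AB)
    then show "y \<in> dual_polytope W" using x by (simp add: mem)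
  qed
  then have "measure lebesgue (dual_polytope W) = measure lebesgue (((*v) B) ` ?T)"
    by (simp only: measure_translation)
  also have "\<dots> = \<bar>det B\<bar> * measure lebesgue ?T"
    using finite_imp_compact_convex_hull[of "insert 0 Basis :: (real ^ 'n::_) set"]
    by (subst measure_linear_image) (auto intro: lmeasurable_compact)
  finally have "normalized_volume (dual_polytope W) = \<bar>det B\<bar> * normalized_volume ?T"
    by (simp add: normalized_volume_def)
  then have vold: "normalized_volume (dual_polytope W) = \<bar>det B\<bar>"
    by (simp add: normalized_volume_std_simplex)
  show ?thesis
    unfolding volW vold using detB b(1) unfolding detA by (simp add: field_simps)
qed

section \<open>Relabelling coordinates\<close>

text \<open>A copy of an arbitrary finite type, well-ordered by some enumeration, so that results about
well-ordered index types become available for the original type through the bijection \<open>unranked\<close>.\<close>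

typedef 'n ranked = "UNIV :: 'n set"
  morphisms unranked Ranked ..

instance ranked :: (finite) finite
proof
  have "(UNIV :: 'a ranked set) \<subseteq> range Ranked"
    by (metis UNIV_I rangeI subsetI unranked_inverse)
  then show "finite (UNIV :: 'a ranked set)"
    by (rule finite_subset) simp
qed

instantiation ranked :: (finite) wellorder
begin

definition "x \<le> y \<longleftrightarrow> to_nat (unranked x) \<le> to_nat (unranked y)" for x y :: "'a ranked"
definition "x < y \<longleftrightarrow> to_nat (unranked x) < to_nat (unranked y)" for x y :: "'a ranked"

instance
proof
  fix x y z :: "'a ranked"
  show "x < y \<longleftrightarrow> x \<le> y \<and> \<not> y \<le> x" "x \<le> x" "x \<le> y \<or> y \<le> x"
    by (auto simp: less_eq_ranked_def less_ranked_def)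
  show "x \<le> z" if "x \<le> y" "y \<le> z"
    using that by (simp add: less_eq_ranked_def)
  show "x = y" if "x \<le> y" "y \<le> x"
  proof -
    from that have "to_nat (unranked x) = to_nat (unranked y)"
      by (simp add: less_eq_ranked_def)
    then show ?thesis by (simp add: unranked_inject)
  qed
next
  fix P :: "'a ranked \<Rightarrow> bool" and a
  assume step: "\<And>x. (\<And>y. y < x \<Longrightarrow> P y) \<Longrightarrow> P x"
  show "P a"
  proof (induction a rule: measure_induct_rule[of "\<lambda>x. to_nat (unranked x)"])
    case (less x)
    show ?case by (rule step) (rule less, simp add: less_ranked_def)
  qed
qed

end

lemma bij_unranked: "bij unranked"
  by (rule o_bij[where g = Ranked]) (auto simp: fun_eq_iff unranked_inverse Ranked_inverse)

definition reindex :: "('m \<Rightarrow> 'n) \<Rightarrow> real ^ 'n \<Rightarrow> real ^ 'm" where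
  "reindex \<pi> x = (\<chi> j. x $ \<pi> j)"

lemma linear_reindex: "linear (reindex \<pi>)"
  by (rule linearI) (simp_all add: reindex_def vec_eq_iff)

context
  fixes \<pi> :: "'m::finite \<Rightarrow> 'n::finite"
  assumes bij: "bij \<pi>"
begin

lemma reindex_inverse: "reindex (inv_into UNIV \<pi>) (reindex \<pi> x) = x" "reindex \<pi> (reindex (inv_into UNIV \<pi>) y) = y"
  using bij by (simp_all add: reindex_def vec_eq_iff bij_is_surj surj_f_inv_f bij_is_inj)

lemma bij_reindex: "bij (reindex \<pi>)"
  by (rule o_bij[where g = "reindex (inv_into UNIV \<pi>)"]) (auto simp: fun_eq_iff reindex_inverse)

lemma inner_reindex: "reindex \<pi> x \<bullet> reindex \<pi> y = x \<bullet> y"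
  using sum.reindex_bij_betw[OF bij, of "\<lambda>i. x $ i * y $ i"]
  by (simp add: inner_vec_def reindex_def)

lemma card_reindex: "CARD('m) = CARD('n)"
  using bij by (rule bij_betw_same_card)

lemma reindex_dual_polytope: "dual_polytope (reindex \<pi> ` Q) = reindex \<pi> ` dual_polytope Q"
proof (intro equalityI subsetI)
  fix y assume y: "y \<in> dual_polytope (reindex \<pi> ` Q)"
  then have "reindex (inv_into UNIV \<pi>) y \<in> dual_polytope Q"
    unfolding dual_polytope_def by (auto simp: reindex_inverse simp flip: inner_reindex)
  then show "y \<in> reindex \<pi> ` dual_polytope Q"
    by (metis imageI reindex_inverse(2))
qed (auto simp: dual_polytope_def inner_reindex)

lemma measurable_reindex: "reindex \<pi> \<in> borel \<rightarrow>\<^sub>M borel"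
  by (intro borel_measurable_continuous_onI linear_continuous_on)
    (simp add: linear_reindex flip: linear_conv_bounded_linear)

text \<open>Lebesgue measure is characterized by its values on boxes, and relabelling the coordinates of a box
permutes its side lengths.\<close>

lemma lborel_reindex: "(lborel :: (real ^ 'm) measure) = distr lborel borel (reindex \<pi>)"
proof (rule lborel_eqI)
  have prod: "(\<Prod>b\<in>(Basis :: (real ^ 'k) set). f \<bullet> b) = (\<Prod>i\<in>UNIV. f $ i)" for f :: "real ^ 'k::finite"
  proof -
    have Basis: "(Basis :: (real ^ 'k) set) = range (\<lambda>i. axis i 1)"
      by (auto simp: Basis_vec_def)
    have "inj (\<lambda>i::'k. axis i (1::real))"
      by (auto simp: inj_def axis_eq_axis)
    then show ?thesis by (simp add: Basis prod.reindex inner_axis)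
  qed
  fix l u :: "real ^ 'm" assume le: "\<And>b. b \<in> Basis \<Longrightarrow> l \<bullet> b \<le> u \<bullet> b"
  have le': "l $ i \<le> u $ i" for i
    using le[of "axis i 1"] by (simp add: inner_axis axis_in_Basis_iff)
  let ?l = "reindex (inv_into UNIV \<pi>) l" and ?u = "reindex (inv_into UNIV \<pi>) u"
  have "reindex \<pi> -` box l u = box ?l ?u"
  proof (intro Set.set_eqI)
    fix x
    have "x \<in> box ?l ?u \<longleftrightarrow> (\<forall>i. l $ inv_into UNIV \<pi> i < x $ i \<and> x $ i < u $ inv_into UNIV \<pi> i)"
      by (simp add: mem_box_cart reindex_def)
    also have "\<dots> \<longleftrightarrow> (\<forall>j. l $ j < x $ \<pi> j \<and> x $ \<pi> j < u $ j)"
      by (metis bij bij_inv_eq_iff)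
    finally show "x \<in> reindex \<pi> -` box l u \<longleftrightarrow> x \<in> box ?l ?u"
      by (simp add: mem_box_cart reindex_def)
  qed
  then have "emeasure (distr lborel borel (reindex \<pi>)) (box l u) = emeasure lborel (box ?l ?u)"
    by (simp add: emeasure_distr measurable_reindex)
  also have "\<dots> = (\<Prod>b\<in>Basis. (?u - ?l) \<bullet> b)"
    using le' by (subst emeasure_lborel_box) (auto simp: Basis_vec_def inner_axis reindex_def)
  also have "(\<Prod>b\<in>Basis. (?u - ?l) \<bullet> b) = (\<Prod>i\<in>UNIV. u $ inv_into UNIV \<pi> i - l $ inv_into UNIV \<pi> i)"
    unfolding prod by (simp add: reindex_def)
  also have "\<dots> = (\<Prod>b\<in>Basis. (u - l) \<bullet> b)"
    unfolding prod using prod.reindex_bij_betw[OF bij_imp_bij_inv[OF bij], of "\<lambda>j. u $ j - l $ j"]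
    by simp
  finally show "emeasure (distr lborel borel (reindex \<pi>)) (box l u) = (\<Prod>b\<in>Basis. (u - l) \<bullet> b)" .
qed simp

lemma normalized_volume_reindex:
  assumes "closed S"
  shows "normalized_volume (reindex \<pi> ` S) = normalized_volume S"
proof -
  have closed: "closed (reindex \<pi> ` S)"
    using assms linear_reindex bij_is_inj[OF bij_reindex] by (rule closed_injective_linear_image)
  have "measure lborel (reindex \<pi> ` S) = measure lborel (reindex \<pi> -` reindex \<pi> ` S)"
    using closed by (subst lborel_reindex) (simp add: measure_distr borel_closed measurable_reindex)
  also have "reindex \<pi> -` reindex \<pi> ` S = S"
    using bij_is_inj[OF bij_reindex] by (rule inj_vimage_image_eq)
  finally show ?thesis
    using closed assms by (simp add: normalized_volume_def card_reindex measure_completion borel_closed)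
qed

end

section \<open>Barycentric coordinates and the volume of the dual\<close>

text \<open>Relabelling coordinates is a linear isometry, so it commutes with convex hulls and with duals and
preserves volumes. This transports the identity from the well-ordered copy of the index type; the
vertex \<open>w 0\<close> becomes the distinguished one, and \<open>g\<close> numbers the others by the coordinates.\<close>

lemma dual_volume:
  fixes w :: "nat \<Rightarrow> real ^ 'n" and b :: "nat \<Rightarrow> real"
  defines "W \<equiv> convex hull (w ` {..CARD('n)})"
  assumes inj: "inj_on w {..CARD('n)}"
    and pos: "\<And>i. i \<le> CARD('n) \<Longrightarrow> b i > 0"
    and one: "(\<Sum>i\<le>CARD('n). b i) = 1"
    and zero: "(\<Sum>i\<le>CARD('n). b i *\<^sub>R w i) = 0"
    and nz: "normalized_volume W \<noteq> 0"
  shows "normalized_volume W * normalized_volume (dual_polytope W) * (\<Prod>i\<le>CARD('n). b i) = 1"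
proof -
  let ?\<phi> = "reindex (unranked :: 'n ranked \<Rightarrow> 'n)"
  have "card (UNIV :: 'n ranked set) = card {1..CARD('n)}"
    using bij_betw_same_card[OF bij_unranked[where ?'a = 'n]] by simp
  then obtain g where g: "bij_betw g (UNIV :: 'n ranked set) {1..CARD('n)}"
    using finite_same_card_bij[of "UNIV :: 'n ranked set" "{1..CARD('n)}"] by auto
  have range_g: "range g = {1..CARD('n)}" and inj_g: "inj g"
    using g by (auto simp: bij_betw_def)
  then have g_bounds: "0 < g i" "g i \<le> CARD('n)" for i
    by (metis Suc_le_eq One_nat_def atLeastAtMost_iff rangeI)+
  have split: "{..CARD('n)} = insert 0 {1..CARD('n)}"
    by auto
  have inj_\<phi>: "inj ?\<phi>"
    using bij_reindex[OF bij_unranked] by (rule bij_is_inj)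
  let ?w = "\<lambda>i. ?\<phi> (w (g i))"
  have image: "insert (?\<phi> (w 0)) (range ?w) = ?\<phi> ` w ` {..CARD('n)}"
  proof -
    have "range ?w = ?\<phi> ` w ` range g"
      by (simp add: image_image)
    then show ?thesis
      unfolding range_g split by simp
  qed
  have hull: "convex hull (insert (?\<phi> (w 0)) (range ?w)) = ?\<phi> ` W"
    unfolding W_def image by (rule convex_hull_linear_image[OF linear_reindex, symmetric])
  have closed: "closed W"
    unfolding W_def by (intro compact_imp_closed finite_imp_compact_convex_hull) simp
  have vol: "normalized_volume (?\<phi> ` W) = normalized_volume W"
    by (rule normalized_volume_reindex[OF bij_unranked closed])
  have vol_dual: "normalized_volume (dual_polytope (?\<phi> ` W)) = normalized_volume (dual_polytope W)"
    unfolding reindex_dual_polytope[OF bij_unranked]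
    by (rule normalized_volume_reindex[OF bij_unranked closed_dual_polytope])
  have "inj_on w (range g)"
    by (rule inj_on_subset[OF inj]) (auto simp: range_g)
  then have "inj ?w"
    using inj_g inj_\<phi> by (auto simp: inj_on_def)
  moreover have "?\<phi> (w 0) \<notin> range ?w"
  proof
    assume "?\<phi> (w 0) \<in> range ?w"
    then obtain i where "w 0 = w (g i)"
      using inj_\<phi> by (auto simp: inj_on_def)
    then show False
      using inj_onD[OF inj, of 0 "g i"] g_bounds[of i] by simp
  qed
  moreover have "b 0 > 0" "b (g i) > 0" for i
    using pos g_bounds by auto
  moreover have "b 0 + (\<Sum>i\<in>UNIV. b (g i)) = 1"
    using one sum.reindex_bij_betw[OF g, of b] unfolding split by simp
  moreover have "b 0 *\<^sub>R ?\<phi> (w 0) + (\<Sum>i\<in>UNIV. b (g i) *\<^sub>R ?w i) = 0"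
  proof -
    have "b 0 *\<^sub>R ?\<phi> (w 0) + (\<Sum>i\<in>UNIV. b (g i) *\<^sub>R ?w i)
        = ?\<phi> (b 0 *\<^sub>R w 0 + (\<Sum>i\<in>UNIV. b (g i) *\<^sub>R w (g i)))"
      by (simp add: linear_add linear_sum linear_cmul linear_reindex)
    also have "b 0 *\<^sub>R w 0 + (\<Sum>i\<in>UNIV. b (g i) *\<^sub>R w (g i)) = 0"
      using zero sum.reindex_bij_betw[OF g, of "\<lambda>i. b i *\<^sub>R w i"] unfolding split by simp
    finally show ?thesis
      by (simp add: linear_0 linear_reindex)
  qed
  ultimately have "normalized_volume (?\<phi> ` W) * normalized_volume (dual_polytope (?\<phi> ` W))
      * (b 0 * (\<Prod>i\<in>UNIV. b (g i))) = 1"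
    using dual_volume_wellorder[of ?w "?\<phi> (w 0)" "b 0" "\<lambda>i. b (g i)"] nz
    unfolding hull vol by blast
  also have "b 0 * (\<Prod>i\<in>UNIV. b (g i)) = (\<Prod>i\<le>CARD('n). b i)"
    using prod.reindex_bij_betw[OF g, of b] unfolding split by simp
  finally show ?thesis
    unfolding vol vol_dual .
qed

lemma barycentric_interior_point:
  fixes v :: "nat \<Rightarrow> real ^ 'n"
  assumes "\<not> affine_dependent C" and v: "bij_betw v {..CARD('n)} C"
    and pos: "\<And>i. i \<le> CARD('n) \<Longrightarrow> u i > 0" and one: "(\<Sum>i\<le>CARD('n). u i) = 1"
  shows "(\<Sum>i\<le>CARD('n). u i *\<^sub>R v i) \<in> interior (convex hull C)"
proof -
  define g where "g x = u (inv_into {..CARD('n)} v x)" for x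
  have g: "g (v i) = u i" if "i \<le> CARD('n)" for i
    using v that by (simp add: g_def bij_betw_def)
  have "card C = Suc CARD('n)"
    using bij_betw_same_card[OF v] by simp
  moreover have "\<forall>x\<in>C. g x > 0"
    using v pos g by (auto simp: bij_betw_def)
  moreover have "sum g C = 1"
    using sum.reindex_bij_betw[OF v, of g] one by (simp add: g)
  moreover have "(\<Sum>x\<in>C. g x *\<^sub>R x) = (\<Sum>i\<le>CARD('n). u i *\<^sub>R v i)"
    using sum.reindex_bij_betw[OF v, of "\<lambda>x. g x *\<^sub>R x"] by (simp add: g)
  ultimately show ?thesis
    using assms(1) by (auto simp: interior_convex_hull_explicit_minimal)
qed

lemma normalized_volume_affinity:
  fixes S :: "(real ^ 'n) set"
  shows "normalized_volume ((\<lambda>x. c *\<^sub>R x + a) ` S) = \<bar>c\<bar> ^ CARD('n) * normalized_volume S"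
  using measure_lebesgue_affine[of c a S] by (simp add: normalized_volume_def)

section \<open>The generator of the group and the interior lattice point\<close>

lemma integer_points_sum:
  "(\<And>i. i \<in> I \<Longrightarrow> f i \<in> integer_points) \<Longrightarrow> (\<Sum>i\<in>I. f i) \<in> integer_points"
  by (simp add: integer_points_def Ints_sum)

text \<open>Membership in \<open>\<Lambda>\<close> only provides some integral representative \<open>y\<close>; as the vertices are integral,
changing the coefficients by integers changes the combination by a lattice vector.\<close>

lemma Lambda_group_sum_integral:
  fixes v :: "nat \<Rightarrow> real ^ 'n"
  assumes x: "torus_point CARD('n) x \<in> Lambda_group v"
    and v: "\<And>i. i \<le> CARD('n) \<Longrightarrow> v i \<in> integer_points"
  shows "(\<Sum>i\<le>CARD('n). x i *\<^sub>R v i) \<in> integer_points"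
proof -
  obtain y where y: "torus_point CARD('n) x = torus_point CARD('n) y"
    and int: "(\<Sum>i\<le>CARD('n). y i *\<^sub>R (v i, 1 :: real)) \<in> integer_points \<times> \<int>"
    using x unfolding Lambda_group_def mem_Collect_eq by (elim exE conjE) (rule that)
  have "fst (\<Sum>i\<le>CARD('n). y i *\<^sub>R (v i, 1 :: real)) \<in> integer_points"
    using int by (metis mem_Times_iff)
  then have "(\<Sum>i\<le>CARD('n). y i *\<^sub>R v i) \<in> integer_points"
    by (simp add: fst_sum)
  moreover have "(\<Sum>i\<le>CARD('n). (x i - y i) *\<^sub>R v i) \<in> integer_points"
  proof (rule integer_points_sum)
    fix i assume i: "i \<in> {..CARD('n)}"
    then have "class_mod_Z (x i) = class_mod_Z (y i)"
      using fun_cong[OF y, of i] by (simp add: torus_point_def)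
    then have "x i - y i \<in> \<int>"
      by (simp add: class_mod_Z_eq_iff)
    then show "(x i - y i) *\<^sub>R v i \<in> integer_points"
      using v[of i] i by (simp add: integer_points_def)
  qed
  ultimately have "(\<Sum>i\<le>CARD('n). y i *\<^sub>R v i) + (\<Sum>i\<le>CARD('n). (x i - y i) *\<^sub>R v i) \<in> integer_points"
    by (simp add: integer_points_def)
  then show ?thesis
    by (simp add: algebra_simps flip: sum.distrib)
qed

lemma sum_three_blocks:
  fixes a b c :: real
  shows "(\<Sum>i<s1 + s2 + s3. if i < s1 then a else if i < s1 + s2 then b else c)
    = real s1 * a + real s2 * b + real s3 * c"
proof (induction s3)
  case 0
  have "(\<Sum>i<s1 + s2. if i < s1 then a else b) = real s1 * a + real s2 * b"
    by (induction s2) (simp_all add: algebra_simps)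
  moreover have "(\<Sum>i<s1 + s2. if i < s1 then a else if i < s1 + s2 then b else c)
      = (\<Sum>i<s1 + s2. if i < s1 then a else b)"
    by (rule sum.cong) auto
  ultimately show ?case by simp
qed (simp add: algebra_simps)

lemma prod_three_blocks:
  fixes a b c :: real
  shows "(\<Prod>i<s1 + s2 + s3. if i < s1 then a else if i < s1 + s2 then b else c)
    = a ^ s1 * b ^ s2 * c ^ s3"
proof (induction s3)
  case 0
  have "(\<Prod>i<s1 + s2. if i < s1 then a else b) = a ^ s1 * b ^ s2"
    by (induction s2) (simp_all add: algebra_simps)
  moreover have "(\<Prod>i<s1 + s2. if i < s1 then a else if i < s1 + s2 then b else c)
      = (\<Prod>i<s1 + s2. if i < s1 then a else b)"
    by (rule prod.cong) auto
  ultimately show ?case by simp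
qed (simp add: algebra_simps)

theorem theorem4p5:
  fixes \<Delta> :: "(real ^ 'n) set" and t :: "real ^ 'n" and p q r s1 s2 s3 :: nat
  assumes "prime p" and "prime q" and "p \<noteq> q" and "r > 0"
    and "int CARD('n) simplex \<Delta>"
    and "gorenstein r \<Delta>"
    and "normalized_volume \<Delta> = real (p * q)"
    and "\<not> is_lattice_pyramid \<Delta>"
    and "interior ((\<lambda>x. real r *\<^sub>R x) ` \<Delta>) \<inter> integer_points = {t}"
    and "s1 + s2 + s3 = CARD('n) + 1"
    and "r * p * q = s1 * q + s2 * p + s3"
    and "\<exists>v. bij_betw v {..CARD('n)} (vertices \<Delta>) \<and>
           generate (torus CARD('n))
             {torus_point CARD('n)
                (\<lambda>i. if i < s1 then 1 / real p
                     else if i < s1 + s2 then 1 / real q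
                     else 1 / real (p * q))} = Lambda_group v"
  shows "normalized_volume (dual_polytope ((\<lambda>x. real r *\<^sub>R x - t) ` \<Delta>)) =
           real r * real p powi (int (s1 + s3) - 1) * real q powi (int (s2 + s3) - 1)"
proof -
  let ?d = "CARD('n)"
  define lam where "lam i = (if i < s1 then 1 / real p else if i < s1 + s2 then 1 / real q
    else 1 / real (p * q))" for i
  obtain v where v: "bij_betw v {..?d} (vertices \<Delta>)"
    and gen: "generate (torus ?d) {torus_point ?d lam} = Lambda_group v"
    using assms(12) unfolding lam_def by blast
  obtain C where C: "\<not> affine_dependent C" "\<Delta> = convex hull C"
    using assms(5) unfolding simplex_def by blast
  have "vertices \<Delta> = C"
    using C by (auto simp: vertices_def extreme_point_of_convex_hull_affine_independent)
  with v have bij: "bij_betw v {..?d} C" by simp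
  have integral: "v i \<in> integer_points" if "i \<le> ?d" for i
    using assms(6) v that by (auto simp: gorenstein_def lattice_polytope_def bij_betw_def)

  have p: "real p > 0" and q: "real q > 0"
    using assms(1,2) by (simp_all add: prime_gt_0_nat)
  have blocks: "{..?d} = {..<s1 + s2 + s3}"
    using assms(10) by auto
  have lam_pos: "lam i > 0" for i
    using p q by (simp add: lam_def)
  have lam_sum: "(\<Sum>i\<le>?d. lam i) = real r"
  proof -
    have "real r * real p * real q = real s1 * real q + real s2 * real p + real s3"
      using arg_cong[OF assms(11), of real] by simp
    then show ?thesis
      unfolding blocks lam_def sum_three_blocks using p q by (simp add: field_simps)
  qed
  have lam_prod: "(\<Prod>i\<le>?d. lam i) = 1 / (real p ^ (s1 + s3) * real q ^ (s2 + s3))"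
    unfolding blocks lam_def prod_three_blocks
    by (simp add: power_add power_mult_distrib power_divide field_simps)

  \<comment> \<open>The barycentric coordinates of \<open>t / r\<close> in \<open>\<Delta>\<close>, hence those of the origin in \<open>r \<Delta> - t\<close>.\<close>
  define b where "b i = lam i / real r" for i
  have b_pos: "b i > 0" for i
    using lam_pos assms(4) by (simp add: b_def)
  have b_sum: "(\<Sum>i\<le>?d. b i) = 1"
    using lam_sum assms(4) by (simp add: b_def flip: sum_divide_distrib)

  have t: "t = (\<Sum>i\<le>?d. lam i *\<^sub>R v i)"
  proof -
    have "torus_point ?d lam \<in> Lambda_group v"
      unfolding gen[symmetric] by (rule generate.incl) simp
    then have "(\<Sum>i\<le>?d. lam i *\<^sub>R v i) \<in> integer_points"
      using integral by (rule Lambda_group_sum_integral)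
    moreover have "(\<Sum>i\<le>?d. lam i *\<^sub>R v i) = real r *\<^sub>R (\<Sum>i\<le>?d. b i *\<^sub>R v i)"
      using assms(4) by (simp add: b_def scaleR_right.sum)
    moreover have "(\<Sum>i\<le>?d. b i *\<^sub>R v i) \<in> interior \<Delta>"
      unfolding C(2) using C(1) bij b_pos b_sum by (rule barycentric_interior_point)
    moreover have "interior ((\<lambda>x. real r *\<^sub>R x) ` \<Delta>) = (\<lambda>x. real r *\<^sub>R x) ` interior \<Delta>"
      using assms(4) by (intro interior_injective_linear_image linear_scaleR) (auto simp: inj_on_def)
    ultimately have "(\<Sum>i\<le>?d. lam i *\<^sub>R v i)
        \<in> interior ((\<lambda>x. real r *\<^sub>R x) ` \<Delta>) \<inter> integer_points"
      by auto
    then show ?thesis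
      unfolding assms(9) by simp
  qed

  define w where "w i = real r *\<^sub>R v i - t" for i
  define W where "W = (\<lambda>x. real r *\<^sub>R x - t) ` \<Delta>"
  have W_hull: "W = convex hull (w ` {..?d})"
  proof -
    have "w ` {..?d} = (\<lambda>x. - t + real r *\<^sub>R x) ` v ` {..?d}"
      by (simp add: w_def image_image)
    also have "v ` {..?d} = C"
      using bij by (simp add: bij_betw_def)
    finally show ?thesis
      using convex_hull_affinity[of "- t" "real r" C] unfolding W_def C(2) by simp
  qed
  have "inj_on w {..?d}"
    using bij assms(4) by (auto simp: bij_betw_def inj_on_def w_def)
  moreover have "(\<Sum>i\<le>?d. b i *\<^sub>R w i) = 0"
  proof -
    have "(\<Sum>i\<le>?d. b i *\<^sub>R w i) = (\<Sum>i\<le>?d. lam i *\<^sub>R v i) - (\<Sum>i\<le>?d. b i) *\<^sub>R t"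
      using assms(4)
      by (simp add: w_def b_def scaleR_diff_right sum_subtractf scaleR_sum_left)
    then show ?thesis
      unfolding b_sum t[symmetric] by simp
  qed
  moreover have vol: "normalized_volume W = real r ^ ?d * (real p * real q)"
    using normalized_volume_affinity[of "real r" "- t" \<Delta>] assms(7) by (simp add: W_def)
  ultimately have "normalized_volume W * normalized_volume (dual_polytope W) * (\<Prod>i\<le>?d. b i) = 1"
    using b_pos b_sum p q assms(4) dual_volume[of w b] unfolding W_hull[symmetric] by simp
  moreover have "(\<Prod>i\<le>?d. b i) = 1 / (real p ^ (s1 + s3) * real q ^ (s2 + s3)) / real r ^ (?d + 1)"
    unfolding b_def prod_dividef lam_prod by simp
  ultimately have "normalized_volume (dual_polytope W)
      = real r * (real p ^ (s1 + s3) / real p) * (real q ^ (s2 + s3) / real q)"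
    unfolding vol using p q assms(4) by (simp add: field_simps)
  moreover have "x powi (int m - 1) = x ^ m / x" if "x > 0" for x :: real and m
    using that by (simp add: power_int_diff)
  ultimately show ?thesis
    using p q by (simp only: W_def)
qed

end
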